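(* For every even integer $k\ge 1$, $$D^{\mathrm{VR}}_{2k+2,k}(\mathbb S^1)=\left\{(t_b,t_d)\in\mathbb R^2:\ \frac{k}{k+1}\pi\le t_b<t_d\le\pi\right\}.$$
   Context: $\mathbb S^1=[0,2\pi]/(0\sim 2\pi)$ with the geodesic distance $d(x,y)=\min(|x-y|,2\pi-|x-y|)$. For a finite metric space $Y$ and $r\ge 0$, $\mathrm{VR}_r(Y)$ is the simplicial complex of nonempty subsets $\sigma\subset Y$ with $\mathrm{diam}(\sigma)\le r$. With a fixed coefficient field $\mathbb F$, the persistence module $r\mapsto\widetilde H_k(\mathrm{VR}_r(Y);\mathbb F)$ (reduced homology) decomposes into finitely many interval modules on intervals $[b_\alpha,d_\alpha)$, and $\mathrm{dgm}_k^{\mathrm{VR}}(Y)$ is the multiset of points $(b_\alpha,d_\alpha)$. If $|Y|\le 2k+2$ this diagram has at most one point. For a metric space $X$, the principal persistence set $D^{\mathrm{VR}}_{2k+2,k}(X)$ is identified with the subset of $\mathbb R^2$ of all $(t_b,t_d)$ such that $\mathrm{dgm}_k^{\mathrm{VR}}(X')=\{(t_b,t_d)\}$ for some $X'\subset X$ with $|X'|\le 2k+2$ (the empty diagram, which always arises, is omitted by convention). *)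

theory Defs
  imports
    "HOL-Analysis.Analysis"
    "HOL-Library.Multiset"
    "HOL-Library.Function_Algebras"
    "HOL-Library.Set_Algebras"
begin

section \<open>The circle with its geodesic distance\<close>

text \<open>
  The quotient of \<open>[0, 2\<pi>]\<close> by \<open>0 \<sim> 2\<pi>\<close> is represented by its system of representatives
  \<open>[0, 2\<pi>)\<close>. The value \<open>0\<close> off the carrier is a junk value: the locale \<open>Metric_space\<close> requires
  nonnegativity and symmetry for all arguments.
\<close>

definition circle_carrier :: "real set" where
  "circle_carrier = {0..<2 * pi}"

definition circle_dist :: "real \<Rightarrow> real \<Rightarrow> real" where
  "circle_dist x y =
     (if x \<in> circle_carrier \<and> y \<in> circle_carrier
      then min \<bar>x - y\<bar> (2 * pi - \<bar>x - y\<bar>) else 0)"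

lemma Metric_space_circle: "Metric_space circle_carrier circle_dist"
proof
  show "0 \<le> circle_dist x y" for x y
    by (auto simp: circle_dist_def circle_carrier_def)
  show "circle_dist x y = circle_dist y x" for x y
    by (auto simp: circle_dist_def abs_minus_commute)
  show "circle_dist x y = 0 \<longleftrightarrow> x = y" if "x \<in> circle_carrier" "y \<in> circle_carrier" for x y
    using that by (auto simp: circle_dist_def circle_carrier_def min_def split: if_splits)
  show "circle_dist x z \<le> circle_dist x y + circle_dist y z"
    if "x \<in> circle_carrier" "y \<in> circle_carrier" "z \<in> circle_carrier" for x y z
    using that unfolding circle_dist_def circle_carrier_def atLeastLessThan_iff
    by (simp add: min_def) linarith
qed

definition circle :: "real metric" where
  "circle = metric (circle_carrier, circle_dist)"

lemma mspace_circle: "mspace circle = {0..<2 * pi}"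
  unfolding circle_def Metric_space.mspace_metric[OF Metric_space_circle]
  by (simp add: circle_carrier_def)

lemma mdist_circle:
  assumes "x \<in> {0..<2 * pi}" and "y \<in> {0..<2 * pi}"
  shows "mdist circle x y = min \<bar>x - y\<bar> (2 * pi - \<bar>x - y\<bar>)"
  using assms unfolding circle_def Metric_space.mdist_metric[OF Metric_space_circle]
  by (simp add: circle_dist_def circle_carrier_def)


section \<open>Vietoris--Rips complexes\<close>

definition mdiam :: "'a metric \<Rightarrow> 'a set \<Rightarrow> real" where
  "mdiam Y \<sigma> = (SUP (x, y) \<in> \<sigma> \<times> \<sigma>. mdist Y x y)"

text \<open>Intended for finite \<open>Y\<close>; then all simplices are finite and the supremum is a maximum.\<close>

definition VR_complex :: "'a metric \<Rightarrow> real \<Rightarrow> 'a set set" where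
  "VR_complex Y r = {\<sigma>. \<sigma> \<noteq> {} \<and> \<sigma> \<subseteq> mspace Y \<and> mdiam Y \<sigma> \<le> r}"

lemma VR_complex_iff:
  assumes "finite (mspace Y)"
  shows "\<sigma> \<in> VR_complex Y r \<longleftrightarrow>
    \<sigma> \<noteq> {} \<and> \<sigma> \<subseteq> mspace Y \<and> (\<forall>x\<in>\<sigma>. \<forall>y\<in>\<sigma>. mdist Y x y \<le> r)"
proof (cases "\<sigma> \<noteq> {} \<and> \<sigma> \<subseteq> mspace Y")
  case True
  then have "finite ((\<lambda>(x, y). mdist Y x y) ` (\<sigma> \<times> \<sigma>))"
    using assms finite_subset by blast
  moreover have "(\<lambda>(x, y). mdist Y x y) ` (\<sigma> \<times> \<sigma>) \<noteq> {}"
    using True by auto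
  ultimately have "mdiam Y \<sigma> \<le> r \<longleftrightarrow> (\<forall>x\<in>\<sigma>. \<forall>y\<in>\<sigma>. mdist Y x y \<le> r)"
    unfolding mdiam_def by (subst cSup_eq_Max) auto
  with True show ?thesis
    by (simp add: VR_complex_def)
qed (auto simp: VR_complex_def)


section \<open>Vector spaces with explicit carriers\<close>

record ('f, 'v) vspace =
  vcarrier :: "'v set"
  vadd :: "'v \<Rightarrow> 'v \<Rightarrow> 'v"
  vscale :: "'f \<Rightarrow> 'v \<Rightarrow> 'v"

definition vspace_iso :: "('f, 'v) vspace \<Rightarrow> ('f, 'w) vspace \<Rightarrow> ('v \<Rightarrow> 'w) \<Rightarrow> bool" where
  "vspace_iso V W \<phi> \<longleftrightarrow>
     bij_betw \<phi> (vcarrier V) (vcarrier W) \<and>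
     (\<forall>x\<in>vcarrier V. \<forall>y\<in>vcarrier V. \<phi> (vadd V x y) = vadd W (\<phi> x) (\<phi> y)) \<and>
     (\<forall>a. \<forall>x\<in>vcarrier V. \<phi> (vscale V a x) = vscale W a (\<phi> x))"


section \<open>Reduced simplicial homology over a field\<close>

text \<open>
  A complex \<open>K\<close> is a finite set of nonempty finite simplices on linearly ordered vertices; the
  order only serves to orient the simplices. A \<open>k\<close>-chain is its coefficient function.
\<close>

definition chains :: "'a set set \<Rightarrow> nat \<Rightarrow> ('a set \<Rightarrow> 'f::field) set" where
  "chains K k = {c. \<forall>\<sigma>. c \<sigma> \<noteq> 0 \<longrightarrow> \<sigma> \<in> K \<and> card \<sigma> = Suc k}"

text \<open>
  Linear extension of \<open>\<partial>[v\<^sub>0, \<dots>, v\<^sub>k] = (\<Sum>i\<le>k. (-1)^i [v\<^sub>0, \<dots>, v\<^sub>i\<^sub>-\<^sub>1, v\<^sub>i\<^sub>+\<^sub>1, \<dots>, v\<^sub>k])\<close> for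
  \<open>v\<^sub>0 < \<dots> < v\<^sub>k\<close>. A vertex has the empty simplex as its face, so the coefficient of the
  boundary of a \<open>0\<close>-chain at \<open>{}\<close> is the augmentation; hence the homology below is reduced.
\<close>

definition boundary ::
    "'a::linorder set set \<Rightarrow> ('a set \<Rightarrow> 'f::field) \<Rightarrow> ('a set \<Rightarrow> 'f)" where
  "boundary K c = (\<lambda>\<tau>. \<Sum>\<sigma>\<in>K. \<Sum>v\<in>\<sigma>.
     if \<tau> = \<sigma> - {v} then (- 1) ^ card {u \<in> \<sigma>. u < v} * c \<sigma> else 0)"

definition cycles :: "'a::linorder set set \<Rightarrow> nat \<Rightarrow> ('a set \<Rightarrow> 'f::field) set" where
  "cycles K k = {c \<in> chains K k. boundary K c = 0}"

definition boundaries :: "'a::linorder set set \<Rightarrow> nat \<Rightarrow> ('a set \<Rightarrow> 'f::field) set" where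
  "boundaries K k = boundary K ` chains K (Suc k)"

text \<open>
  The quotient of cycles by boundaries; elements are cosets. In the scalar multiplication,
  adding the boundaries again matters only for the scalar \<open>0\<close>.
\<close>

definition homology ::
    "'a::linorder set set \<Rightarrow> nat \<Rightarrow> ('f::field, ('a set \<Rightarrow> 'f) set) vspace" where
  "homology K k =
     \<lparr>vcarrier = (\<lambda>z. z +o boundaries K k) ` cycles K k,
      vadd = (\<lambda>x y. x + y),
      vscale = (\<lambda>a x. (\<lambda>z \<sigma>. a * z \<sigma>) ` x + boundaries K k)\<rparr>"

text \<open>The map into the homology of \<open>L\<close> induced by an inclusion \<open>K \<subseteq> L\<close>.\<close>

definition homology_map ::
    "'a::linorder set set \<Rightarrow> nat \<Rightarrow> ('a set \<Rightarrow> 'f::field) set \<Rightarrow> ('a set \<Rightarrow> 'f) set" where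
  "homology_map L k x = x + boundaries L k"


section \<open>Persistence modules and diagrams\<close>

text \<open>Only indices \<open>r \<ge> 0\<close> are relevant, and structure maps only for \<open>r \<le> s\<close>.\<close>

record ('f, 'v) pmodule =
  pspace :: "real \<Rightarrow> ('f, 'v) vspace"
  pmap :: "real \<Rightarrow> real \<Rightarrow> 'v \<Rightarrow> 'v"

definition pmodule_isomorphic :: "('f, 'v) pmodule \<Rightarrow> ('f, 'w) pmodule \<Rightarrow> bool" where
  "pmodule_isomorphic V W \<longleftrightarrow>
     (\<exists>\<phi>. (\<forall>r\<ge>0. vspace_iso (pspace V r) (pspace W r) (\<phi> r)) \<and>
          (\<forall>r s. 0 \<le> r \<longrightarrow> r \<le> s \<longrightarrow>
            (\<forall>x\<in>vcarrier (pspace V r). \<phi> s (pmap V r s x) = pmap W r s (\<phi> r x))))"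

text \<open>
  The direct sum of the interval modules on \<open>[b, d)\<close>, for \<open>(b, d)\<close> in the list \<open>I\<close>: at \<open>r\<close> it is
  the space of families in the field, indexed by those \<open>i\<close> whose interval contains \<open>r\<close>.
\<close>

definition interval_sum :: "(real \<times> real) list \<Rightarrow> ('f::field, nat \<Rightarrow> 'f) pmodule" where
  "interval_sum I =
     (let A = (\<lambda>r. {i. i < length I \<and> fst (I ! i) \<le> r \<and> r < snd (I ! i)}) in
      \<lparr>pspace = (\<lambda>r. \<lparr>vcarrier = {f. \<forall>i. i \<notin> A r \<longrightarrow> f i = 0},
                       vadd = (\<lambda>f g i. f i + g i),
                       vscale = (\<lambda>a f i. a * f i)\<rparr>),
       pmap = (\<lambda>r s f i. if i \<in> A r \<inter> A s then f i else 0)\<rparr>)"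

definition VR_pmodule ::
    "'a::linorder metric \<Rightarrow> nat \<Rightarrow> ('f::field, ('a set \<Rightarrow> 'f) set) pmodule" where
  "VR_pmodule Y k =
     \<lparr>pspace = (\<lambda>r. homology (VR_complex Y r) k),
      pmap = (\<lambda>r s. homology_map (VR_complex Y s) k)\<rparr>"

text \<open>
  \<open>is_VR_dgm TYPE('f) Y k M\<close>: the degree \<open>k\<close> Vietoris--Rips persistence diagram of the finite
  metric space \<open>Y\<close>, with coefficients in \<open>'f\<close>, is the multiset \<open>M\<close>. It is a relation because
  existence and uniqueness of interval decompositions are theorems.
\<close>

definition is_VR_dgm ::
    "'f::field itself \<Rightarrow> 'a::linorder metric \<Rightarrow> nat \<Rightarrow> (real \<times> real) multiset \<Rightarrow> bool" where
  "is_VR_dgm F Y k M \<longleftrightarrow>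
     (\<exists>I. mset I = M \<and> (\<forall>(b, d)\<in>set I. 0 \<le> b \<and> b < d) \<and>
          pmodule_isomorphic
            (VR_pmodule Y k :: ('f, ('a set \<Rightarrow> 'f) set) pmodule)
            (interval_sum I :: ('f, nat \<Rightarrow> 'f) pmodule))"

text \<open>
  The principal persistence set \<open>D\<^sub>n\<^sub>,\<^sub>k(X)\<close> with \<open>n = 2k + 2\<close>, as a set of points; the empty
  diagram is omitted.
\<close>

definition VR_principal_set ::
    "'f::field itself \<Rightarrow> 'a::linorder metric \<Rightarrow> nat \<Rightarrow> (real \<times> real) set" where
  "VR_principal_set F X k =
     {(t\<^sub>b, t\<^sub>d). \<exists>Y \<subseteq> mspace X. finite Y \<and> card Y \<le> 2 * k + 2 \<and>
                 is_VR_dgm F (submetric X Y) k {#(t\<^sub>b, t\<^sub>d)#}}"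

end

theory Submission
  imports Defs
begin

text \<open>
  The clique complex of a graph on at most \<open>2k + 2\<close> vertices has nonzero reduced homology in
  degree \<open>k\<close> only if it is the boundary of the cross-polytope, i.e. if there are exactly
  \<open>2k + 2\<close> vertices and each has a unique non-neighbour (its antipode). This follows by induction
  on the number of vertices, splitting off the star of one vertex. On the circle, the chords
  joining antipodes must cross pairwise, so the antipode of the \<open>i\<close>-th point in cyclic order is
  the \<open>(i + k + 1)\<close>-th; hence the \<open>2k + 2\<close> arcs spanning \<open>k\<close> consecutive steps all have
  length at most \<open>t\<^sub>b\<close>. They cover the circle \<open>k\<close> times, so \<open>2\<pi>k \<le> (2k + 2) t\<^sub>b\<close>.
  Conversely, for \<open>k = 2h\<close> take \<open>2h + 1\<close> points whose longest \<open>h\<close>-step arc is \<open>t\<^sub>b\<close>, together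
  with their images under the rotation by \<open>t\<^sub>d\<close>.
\<close>

section \<open>Homology of small clique complexes\<close>

text \<open>
  Unlike in \<open>chains\<close>, the index \<open>m\<close> is the number of vertices, and the empty simplex is allowed:
  degree \<open>-1\<close> is what lets the inductions below start at \<open>m = 0\<close>.
\<close>

definition clique_chains :: "'a set \<Rightarrow> ('a \<Rightarrow> 'a \<Rightarrow> bool) \<Rightarrow> nat \<Rightarrow> ('a set \<Rightarrow> 'f::field) set" where
  "clique_chains V E m = {c. \<forall>\<sigma>. c \<sigma> \<noteq> 0 \<longrightarrow> \<sigma> \<subseteq> V \<and> card \<sigma> = m \<and> pairwise E \<sigma>}"

section \<open>Signs, boundaries and cones\<close>

definition vsign :: "'a::linorder \<Rightarrow> 'a set \<Rightarrow> 'f::field" where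
  "vsign v \<tau> = (- 1) ^ card {u \<in> \<tau>. u < v}"

text \<open>The simplicial boundary read off coefficientwise, by collecting the cofaces of
  \<open>\<tau>\<close>. It depends on the vertex set alone, so one operator serves all graphs and
  all scales.\<close>

definition bd :: "'a::linorder set \<Rightarrow> ('a set \<Rightarrow> 'f::field) \<Rightarrow> 'a set \<Rightarrow> 'f" where
  "bd V c \<tau> = (\<Sum>v\<in>V - \<tau>. vsign v \<tau> * c (insert v \<tau>))"

text \<open>The join with \<open>v\<close>; the sign accounts for placing \<open>v\<close> first in
  the orientation.\<close>

definition cone_chain :: "'a::linorder \<Rightarrow> ('a set \<Rightarrow> 'f::field) \<Rightarrow> 'a set \<Rightarrow> 'f" where
  "cone_chain v a \<sigma> = (if v \<in> \<sigma> then vsign v (\<sigma> - {v}) * a (\<sigma> - {v}) else 0)"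

lemma vsign_square [simp]: "vsign v \<tau> * (vsign v \<tau> :: 'f::field) = 1"
  unfolding vsign_def by (simp flip: power_add)

lemma vsign_square_left [simp]: "vsign v \<tau> * (vsign v \<tau> * x) = (x :: 'f::field)"
  by (simp flip: mult.assoc)

lemma vsign_nonzero [simp]: "vsign v \<tau> \<noteq> (0 :: 'f::field)"
  unfolding vsign_def by simp

lemma vsign_insert:
  assumes "finite \<rho>" "u \<notin> \<rho>"
  shows "vsign v (insert u \<rho>) = (if u < v then - vsign v \<rho> else vsign v \<rho> :: 'f::field)"
proof -
  have "{w \<in> insert u \<rho>. w < v} = (if u < v then insert u {w \<in> \<rho>. w < v} else {w \<in> \<rho>. w < v})"
    by auto
  then show ?thesis
    using assms by (simp add: vsign_def)
qed

text \<open>Exactly one of the two insertions flips the sign of the other vertex: the cancellation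
  that makes coning anticommute with the boundary away from the base.\<close>

lemma vsign_anticommute:
  assumes "finite \<rho>" "u \<notin> \<rho>" "v \<notin> \<rho>" "u \<noteq> v"
  shows "vsign u (insert v \<rho>) * vsign v (insert u \<rho>) = - (vsign v \<rho> * vsign u \<rho> :: 'f::field)"
  using assms by (auto simp: vsign_insert)

lemma bd_add: "bd V (a + b) = bd V a + bd V b"
  by (simp add: fun_eq_iff bd_def algebra_simps sum.distrib)

lemma bd_diff: "bd V (a - b) = bd V a - bd V b"
  by (simp add: fun_eq_iff bd_def algebra_simps sum_subtractf)

lemma bd_zero [simp]: "bd V 0 = 0"
  by (simp add: fun_eq_iff bd_def)

lemma bd_scale: "bd V (\<lambda>\<sigma>. x * c \<sigma>) = (\<lambda>\<sigma>. x * bd V c \<sigma>)"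
  by (simp add: fun_eq_iff bd_def sum_distrib_left algebra_simps)

lemma cone_chain_zero [simp]: "cone_chain v 0 = 0"
  by (simp add: fun_eq_iff cone_chain_def)

lemma clique_chains_zero [simp]: "0 \<in> clique_chains V E m"
  by (simp add: clique_chains_def)

lemma clique_chains_add:
  "a \<in> clique_chains V E m \<Longrightarrow> b \<in> clique_chains V E m \<Longrightarrow> a + b \<in> clique_chains V E m"
  unfolding clique_chains_def by (clarsimp, metis add.right_neutral)

lemma clique_chains_diff:
  "a \<in> clique_chains V E m \<Longrightarrow> b \<in> clique_chains V E m \<Longrightarrow> a - b \<in> clique_chains V E m"
  unfolding clique_chains_def by (clarsimp, metis diff_zero)

lemma clique_chains_scale:
  "c \<in> clique_chains V E m \<Longrightarrow> (\<lambda>\<sigma>. x * c \<sigma>) \<in> clique_chains V E m"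
  unfolding clique_chains_def by simp

lemma clique_chains_mono:
  "W \<subseteq> V \<Longrightarrow> clique_chains W E m \<subseteq> clique_chains V E m"
  unfolding clique_chains_def by blast

lemma clique_chainsD:
  assumes "c \<in> clique_chains V E m" "c \<sigma> \<noteq> 0"
  shows "\<sigma> \<subseteq> V" "card \<sigma> = m" "pairwise E \<sigma>"
  using assms by (auto simp: clique_chains_def)

lemma clique_chains_not_subset:
  "c \<in> clique_chains V E m \<Longrightarrow> \<not> \<sigma> \<subseteq> V \<Longrightarrow> c \<sigma> = 0"
  by (auto simp: clique_chains_def)

lemma cone_chain_clique_chains:
  assumes "finite L" "L \<subseteq> W" "v \<in> W" "v \<notin> L" "\<forall>u\<in>L. E u v \<and> E v u"
    and "a \<in> clique_chains L E m"
  shows "cone_chain v a \<in> clique_chains W E (Suc m)"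
proof -
  have "\<sigma> \<subseteq> W \<and> card \<sigma> = Suc m \<and> pairwise E \<sigma>" if "cone_chain v a \<sigma> \<noteq> 0" for \<sigma>
  proof -
    have v: "v \<in> \<sigma>" and "a (\<sigma> - {v}) \<noteq> 0"
      using that by (auto simp: cone_chain_def split: if_splits)
    note * = clique_chainsD[OF assms(6) this(2)]
    have "pairwise E (insert v (\<sigma> - {v}))"
      using * assms(5) by (subst pairwise_insert) blast
    moreover have "card (insert v (\<sigma> - {v})) = Suc m"
      using *(2) finite_subset[OF *(1) assms(1)] by (subst card_insert_disjoint) auto
    moreover have "insert v (\<sigma> - {v}) = \<sigma>"
      using v by auto
    ultimately show ?thesis
      using * assms v by auto
  qed
  then show ?thesis
    by (simp add: clique_chains_def)
qed

text \<open>A simplex without \<open>v\<close> has only one relevant coface, the one obtained by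
  adding \<open>v\<close>. A simplex containing \<open>v\<close> collects the cofaces of its face
  opposite to \<open>v\<close>, with reversed sign.\<close>

lemma bd_cone_chain:
  fixes a :: "'a::linorder set \<Rightarrow> 'f::field"
  assumes V: "finite V" "v \<in> V" and a: "a \<in> clique_chains L E m" "L \<subseteq> V" "v \<notin> L"
  shows "bd V (cone_chain v a) = a - cone_chain v (bd V a)"
proof
  fix \<tau>
  have a0: "a \<sigma> = 0" if "v \<in> \<sigma>" for \<sigma>
    using a that by (metis clique_chains_not_subset in_mono)
  show "bd V (cone_chain v a) \<tau> = (a - cone_chain v (bd V a)) \<tau>"
  proof (cases "v \<in> \<tau>")
    case False
    have "bd V (cone_chain v a) \<tau> = (\<Sum>u\<in>V - \<tau>. if u = v then a \<tau> else 0)"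
      unfolding bd_def using False by (intro sum.cong) (auto simp: cone_chain_def)
    also have "\<dots> = a \<tau>"
      using False V by simp
    finally show ?thesis
      using False by (simp add: cone_chain_def)
  next
    case True
    define \<rho> where "\<rho> = \<tau> - {v}"
    have \<rho>: "\<tau> = insert v \<rho>" "v \<notin> \<rho>"
      using True by (auto simp: \<rho>_def)
    have *: "vsign u \<tau> * cone_chain v a (insert u \<tau>) = - (vsign v \<rho> * (vsign u \<rho> * a (insert u \<rho>)))"
      if u: "u \<in> V - \<tau>" for u
    proof (cases "finite \<rho>")
      case True
      have "insert u \<tau> - {v} = insert u \<rho>"
        using u \<rho> by auto
      then have "vsign u \<tau> * cone_chain v a (insert u \<tau>)
          = (vsign u (insert v \<rho>) * vsign v (insert u \<rho>)) * a (insert u \<rho>)"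
        using \<rho> by (simp add: cone_chain_def)
      also have "\<dots> = - (vsign v \<rho> * vsign u \<rho>) * a (insert u \<rho>)"
        using u \<rho> True by (subst vsign_anticommute) auto
      finally show ?thesis by simp
    next
      case False
      \<comment> \<open>Chains are supported on subsets of the finite set \<open>V\<close>, so both
        sides vanish if \<open>\<rho>\<close> is infinite.\<close>
      then have *: "a \<sigma> = 0" if "\<rho> \<subseteq> \<sigma>" for \<sigma>
        using a V that by (metis clique_chains_not_subset finite_subset subset_trans)
      have "\<rho> \<subseteq> insert u \<tau> - {v}"
        using \<rho> by auto
      then show ?thesis
        by (simp add: cone_chain_def * subset_insertI)
    qed
    have "bd V (cone_chain v a) \<tau> = - (vsign v \<rho> * (\<Sum>u\<in>V - \<tau>. vsign u \<rho> * a (insert u \<rho>)))"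
      unfolding bd_def sum_distrib_left sum_negf[symmetric] using * by (intro sum.cong) auto
    also have "(\<Sum>u\<in>V - \<tau>. vsign u \<rho> * a (insert u \<rho>)) = bd V a \<rho>"
      unfolding bd_def using V \<rho> a0 by (intro sum.mono_neutral_left) auto
    also have "vsign v \<rho> * bd V a \<rho> = cone_chain v (bd V a) \<tau>"
      using True by (simp add: cone_chain_def \<rho>_def)
    finally show ?thesis
      using True a0 by simp
  qed
qed

section \<open>Acyclicity of small clique complexes\<close>

text \<open>Vanishing of reduced homology in degree \<open>m - 1\<close>. The ambient
  \<open>V\<close> in \<open>bd\<close> stays fixed while \<open>W\<close> shrinks, so that chains
  on different vertex sets can be combined.\<close>

definition exact :: "'f::field itself \<Rightarrow> 'a::linorder set \<Rightarrow> ('a \<Rightarrow> 'a \<Rightarrow> bool) \<Rightarrow> 'a set \<Rightarrow> nat \<Rightarrow> bool" where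
  "exact F V E W m \<longleftrightarrow> (\<forall>z \<in> clique_chains W E m. bd V z = 0 \<longrightarrow>
     (\<exists>c \<in> clique_chains W E (Suc m). bd V c = (z :: 'a set \<Rightarrow> 'f)))"

text \<open>The link of a vertex in a clique complex is again a clique complex, given by its
  vertices. Both directions of \<open>E\<close> appear because \<open>pairwise\<close> ranges over
  ordered pairs.\<close>

definition link :: "('a \<Rightarrow> 'a \<Rightarrow> bool) \<Rightarrow> 'a set \<Rightarrow> 'a \<Rightarrow> 'a set" where
  "link E W v = {u \<in> W - {v}. E u v \<and> E v u}"

text \<open>
  Chain-level Mayer--Vietoris for the decomposition of a complex into the star of \<open>v\<close> and
  the deletion of \<open>v\<close>.
\<close>

lemma exact_step:
  assumes V: "finite V" "W \<subseteq> V" "v \<in> W"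
    and ex: "link E W v = W - {v} \<or>
      exact TYPE('f::field) V E (link E W v) m \<and> exact TYPE('f) V E (W - {v}) (Suc m)"
  shows "exact TYPE('f) V E W (Suc m)"
  unfolding exact_def
proof (intro ballI impI)
  fix z :: "'a::linorder set \<Rightarrow> 'f"
  assume z: "z \<in> clique_chains W E (Suc m)" and z0: "bd V z = 0"
  define L where "L = link E W v"
  \<comment> \<open>\<open>z\<close> will be the cone over \<open>a\<close> plus \<open>b\<close>:
    \<open>a\<close> comes from the simplices through \<open>v\<close>, \<open>b\<close> from those
    avoiding it.\<close>
  define a where "a \<tau> = (if v \<in> \<tau> then 0 else vsign v \<tau> * z (insert v \<tau>))" for \<tau>
  define b where "b \<sigma> = (if v \<in> \<sigma> then 0 else z \<sigma>)" for \<sigma>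
  have L: "finite L" "L \<subseteq> W" "L \<subseteq> V" "L \<subseteq> W - {v}" "v \<notin> L" "\<forall>u\<in>L. E u v \<and> E v u"
    using V by (auto simp: L_def link_def intro: finite_subset)
  have W: "finite (W - {v})" "W - {v} \<subseteq> V"
    using V finite_subset by auto
  have a: "a \<in> clique_chains L E m"
    unfolding clique_chains_def
  proof (intro CollectI allI impI)
    fix \<sigma> assume "a \<sigma> \<noteq> 0"
    then have "v \<notin> \<sigma>" "z (insert v \<sigma>) \<noteq> 0"
      by (auto simp: a_def split: if_splits)
    moreover from this have "finite \<sigma>"
      using z V by (meson clique_chainsD(1) finite_insert finite_subset)
    ultimately show "\<sigma> \<subseteq> L \<and> card \<sigma> = m \<and> pairwise E \<sigma>"
      using clique_chainsD[OF z, of "insert v \<sigma>"]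
      by (auto simp: L_def link_def pairwise_insert)
  qed
  have b: "b \<in> clique_chains (W - {v}) E (Suc m)"
    using z by (auto simp: clique_chains_def b_def)
  have zab: "z = cone_chain v a + b"
    by (auto simp: fun_eq_iff cone_chain_def a_def b_def insert_absorb)
  have "v \<in> V" using V by auto
  note bdc = bd_cone_chain[OF \<open>finite V\<close> this]
  have sum0: "a - cone_chain v (bd V a) + bd V b = 0"
    using z0 bdc[OF a] L by (simp add: zab bd_add)
  have v0: "a \<tau> = 0" "bd V b \<tau> = 0" "bd V a \<tau> = 0" if "v \<in> \<tau>" for \<tau>
    using that by (simp_all add: a_def bd_def b_def)
  \<comment> \<open>On simplices avoiding \<open>v\<close> the cone term of \<open>sum0\<close>
    vanishes; on those containing \<open>v\<close> only the cone term remains, which yields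
    \<open>bda\<close> below.\<close>
  have bdb: "bd V b = - a"
  proof
    fix \<tau>
    show "bd V b \<tau> = (- a) \<tau>"
      using fun_cong[OF sum0, of \<tau>] v0[of \<tau>]
      by (cases "v \<in> \<tau>") (auto simp: cone_chain_def add_eq_0_iff fun_Compl_def)
  qed
  have bda: "bd V a = 0"
  proof
    fix \<tau>
    show "bd V a \<tau> = 0 \<tau>"
      using fun_cong[OF sum0, of "insert v \<tau>"] v0[of \<tau>] v0[of "insert v \<tau>"]
      by (cases "v \<in> \<tau>") (auto simp: cone_chain_def)
  qed
  show "\<exists>c \<in> clique_chains W E (Suc (Suc m)). bd V c = z"
  proof (cases "L = W - {v}")
    case True
    \<comment> \<open>If \<open>v\<close> is an apex, the cone over \<open>b\<close> already fills
      \<open>z\<close>.\<close>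
    have "bd V (cone_chain v b) = b - cone_chain v (- a)"
      using bdc[OF b W(2)] bdb by simp
    also have "cone_chain v (- a) = - cone_chain v a"
      by (auto simp: cone_chain_def fun_eq_iff)
    finally have "bd V (cone_chain v b) = z"
      by (simp add: zab fun_eq_iff)
    moreover have "cone_chain v b \<in> clique_chains W E (Suc (Suc m))"
      using b L V True W by (intro cone_chain_clique_chains[where L = "W - {v}"]) auto
    ultimately show ?thesis by blast
  next
    case False
    then have ex: "exact TYPE('f) V E L m" "exact TYPE('f) V E (W - {v}) (Suc m)"
      using ex by (auto simp: L_def)
    \<comment> \<open>Fill \<open>a\<close> by \<open>c\<close> in the link. Then
      \<open>b + c\<close> is a cycle in the deletion, filled by \<open>e\<close>, and subtracting
      the cone over \<open>c\<close> restores the part of \<open>z\<close> through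
      \<open>v\<close>.\<close>
    obtain c where c: "c \<in> clique_chains L E (Suc m)" "bd V c = a"
      using ex(1) a bda by (auto simp: exact_def)
    have "b + c \<in> clique_chains (W - {v}) E (Suc m)"
      using clique_chains_add b c(1) clique_chains_mono[OF L(4)] by blast
    moreover have "bd V (b + c) = 0"
      by (simp add: bd_add c bdb)
    ultimately obtain e where e: "e \<in> clique_chains (W - {v}) E (Suc (Suc m))" "bd V e = b + c"
      using ex(2) by (auto simp: exact_def)
    have "bd V (e - cone_chain v c) = z"
      using bdc[OF c(1)] L by (simp add: bd_diff e c zab)
    moreover have "cone_chain v c \<in> clique_chains W E (Suc (Suc m))"
      using c L V by (intro cone_chain_clique_chains[where L = L]) auto
    moreover have "e \<in> clique_chains W E (Suc (Suc m))"
      using e clique_chains_mono[of "W - {v}" W] by blast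
    ultimately show ?thesis
      using clique_chains_diff by blast
  qed
qed

text \<open>Induction on \<open>W\<close>: unless \<open>v\<close> is an apex, its link misses
  \<open>v\<close> and a non-neighbour, so the link has fewer than \<open>2 * (m - 1)\<close>
  vertices, while the deletion still has fewer than \<open>2 * m\<close>.\<close>

lemma exact_if_card_less:
  assumes "finite V" "W \<subseteq> V" "card W < 2 * m"
  shows "exact TYPE('f::field) V E W m"
  using assms(2,3)
proof (induction "card W" arbitrary: W m rule: less_induct)
  case less
  then obtain n where m: "m = Suc n"
    by (cases m) auto
  have fin: "finite W"
    using less assms finite_subset by blast
  show ?case
  proof (cases "W = {}")
    case True
    have "z = 0" if "z \<in> clique_chains {} E m" for z :: "'a set \<Rightarrow> 'f"
      using that by (fastforce simp: clique_chains_def m fun_eq_iff)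
    then show ?thesis
      by (metis True bd_zero clique_chains_zero exact_def)
  next
    case False
    then obtain v where v: "v \<in> W" by auto
    have "exact TYPE('f) V E (link E W v) n" if "link E W v \<noteq> W - {v}"
    proof -
      have "link E W v \<subset> W - {v}"
        using that by (auto simp: link_def)
      then have "card (link E W v) < card (W - {v})"
        using fin by (intro psubset_card_mono) auto
      moreover have "card (W - {v}) = card W - 1"
        using v fin by simp
      ultimately show ?thesis
        using less by (intro less.hyps) (auto simp: m link_def)
    qed
    moreover have "exact TYPE('f) V E (W - {v}) (Suc n)"
      using v fin less card_Diff1_less[of W v] by (intro less.hyps) (auto simp: m)
    ultimately show ?thesis
      unfolding m using exact_step[of V W v E n] assms less v by blast
  qed
qed

text \<open>A vertex without non-neighbours is an apex. With two or more, its link has at most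
  \<open>2 * m - 3\<close> vertices, so both link and deletion fall under the previous bound. Read
  contrapositively, nonzero homology gives every vertex a unique antipode.\<close>

lemma exact_if_not_antipodal:
  assumes V: "finite V" "card V \<le> 2 * m" and v: "v \<in> V"
    and non: "card {u \<in> V - {v}. \<not> (E u v \<and> E v u)} \<noteq> 1"
  shows "exact TYPE('f::field) V E V m"
proof -
  let ?N = "{u \<in> V - {v}. \<not> (E u v \<and> E v u)}"
  have "card V > 0"
    using V v card_gt_0_iff by blast
  then obtain n where m: "m = Suc n"
    using V by (cases m) auto
  have c: "card (V - {v}) = card V - 1"
    using v V by simp
  have "exact TYPE('f) V E (link E V v) n" if ne: "link E V v \<noteq> V - {v}"
  proof (rule exact_if_card_less)
    have "?N \<noteq> {}"
      using ne by (auto simp: link_def)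
    then have "card ?N \<noteq> 0"
      using V by (subst card_0_eq) auto
    then have "card ?N \<ge> 2"
      using non by linarith
    moreover have "card (link E V v \<union> ?N) = card (link E V v) + card ?N"
      using V by (intro card_Un_disjoint) (auto simp: link_def)
    moreover have "link E V v \<union> ?N = V - {v}"
      by (auto simp: link_def)
    ultimately show "card (link E V v) < 2 * n"
      using V c m by simp
  qed (use V in \<open>auto simp: link_def\<close>)
  moreover have "exact TYPE('f) V E (V - {v}) (Suc n)"
    using V m c \<open>card V > 0\<close> by (intro exact_if_card_less) auto
  ultimately show ?thesis
    unfolding m using exact_step[of V V v E n] V v by blast
qed

section \<open>Transfer to Vietoris--Rips homology\<close>

lemma homology_trivial:
  fixes K :: "'a::linorder set set"
  assumes K: "chains K k = (clique_chains V E (Suc k) :: ('a set \<Rightarrow> 'f::field) set)"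
      "chains K (Suc k) = (clique_chains V E (Suc (Suc k)) :: ('a set \<Rightarrow> 'f) set)"
    and bd: "\<And>c :: 'a set \<Rightarrow> 'f. c \<in> chains K k \<Longrightarrow> boundary K c = bd V c"
      "\<And>c :: 'a set \<Rightarrow> 'f. c \<in> chains K (Suc k) \<Longrightarrow> boundary K c = bd V c"
    and ex: "exact TYPE('f) V E V (Suc k)"
  shows "vcarrier (homology K k :: ('f, _) vspace) \<subseteq> {boundaries K k}"
proof -
  have B: "(boundaries K k :: ('a set \<Rightarrow> 'f) set) = bd V ` clique_chains V E (Suc (Suc k))"
    unfolding boundaries_def K(2)[symmetric] using bd(2) by (simp cong: image_cong)
  have "z +o boundaries K k = boundaries K k" if z: "z \<in> cycles K k" for z :: "'a set \<Rightarrow> 'f"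
  proof -
    have "z \<in> clique_chains V E (Suc k)" "bd V z = 0"
      using z K(1) bd(1) by (auto simp: cycles_def)
    then obtain c where c: "c \<in> clique_chains V E (Suc (Suc k))" "bd V c = z"
      using ex by (auto simp: exact_def)
    have "bd V c + bd V e \<in> bd V ` clique_chains V E (Suc (Suc k))"
      if "e \<in> clique_chains V E (Suc (Suc k))" for e
      using clique_chains_add[OF c(1) that] by (metis bd_add imageI)
    moreover have "\<exists>e' \<in> clique_chains V E (Suc (Suc k)). bd V e = bd V c + bd V e'"
      if "e \<in> clique_chains V E (Suc (Suc k))" for e
      using clique_chains_diff[OF that c(1)] by (intro bexI[of _ "e - c"]) (simp_all add: bd_diff)
    ultimately show ?thesis
      unfolding B elt_set_plus_def c(2)[symmetric] by (intro equalityI subsetI) blast+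
  qed
  then show ?thesis
    by (auto simp: homology_def)
qed

context
  fixes Y :: "'a::linorder metric" and r :: real
  assumes fin: "finite (mspace Y)" and r: "r \<ge> 0"
begin

lemma chains_VR_complex:
  "chains (VR_complex Y r) k = clique_chains (mspace Y) (\<lambda>x y. mdist Y x y \<le> r) (Suc k)"
proof -
  have "\<sigma> \<in> VR_complex Y r \<and> card \<sigma> = Suc k \<longleftrightarrow>
      \<sigma> \<subseteq> mspace Y \<and> card \<sigma> = Suc k \<and> pairwise (\<lambda>x y. mdist Y x y \<le> r) \<sigma>" for \<sigma>
  proof -
    have "mdist Y x y \<le> r" if "x = y" "x \<in> mspace Y" for x y
      using that r by (simp add: Metric_space.mdist_zero[OF Metric_space_mspace_mdist])
    then show ?thesis
      unfolding VR_complex_iff[OF fin] pairwise_def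
      by (metis card.empty nat.distinct(1) subsetD)
  qed
  then show ?thesis
    by (simp add: chains_def clique_chains_def)
qed

text \<open>Pairs of a simplex and a vertex whose removal leaves \<open>\<tau>\<close> correspond to
  the vertices that can be added to \<open>\<tau>\<close>; additions leaving the complex contribute
  nothing, as \<open>c\<close> vanishes there.\<close>

lemma boundary_VR_complex:
  fixes c :: "'a set \<Rightarrow> 'f::field"
  assumes c: "c \<in> chains (VR_complex Y r) k"
  shows "boundary (VR_complex Y r) c = bd (mspace Y) c"
proof
  fix \<tau>
  let ?K = "VR_complex Y r" and ?V = "mspace Y"
  have K: "\<sigma> \<subseteq> ?V" if "\<sigma> \<in> ?K" for \<sigma>
    using that by (simp add: VR_complex_def)
  have fK: "finite ?K"
    using K fin by (intro finite_subset[of ?K "Pow ?V"]) auto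
  let ?g = "\<lambda>(\<sigma>, v). (- 1) ^ card {u \<in> \<sigma>. u < v} * c \<sigma>"
  let ?S = "{(\<sigma>, v). \<sigma> \<in> ?K \<and> v \<in> \<sigma> \<and> \<tau> = \<sigma> - {v}}"
  have "boundary ?K c \<tau> = (\<Sum>(\<sigma>, v)\<in>Sigma ?K (\<lambda>\<sigma>. \<sigma>). if \<tau> = \<sigma> - {v} then ?g (\<sigma>, v) else 0)"
    unfolding boundary_def using fK fin K
    by (subst sum.Sigma) (auto intro: finite_subset)
  also have "\<dots> = sum ?g ?S"
    using fK fin K
    by (intro sum.mono_neutral_cong_right) (auto intro: finite_subset split: if_splits)
  also have "\<dots> = (\<Sum>v\<in>{v \<in> ?V - \<tau>. insert v \<tau> \<in> ?K}. vsign v \<tau> * c (insert v \<tau>))"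
  proof (rule sum.reindex_bij_witness[where j = snd and i = "\<lambda>v. (insert v \<tau>, v)"], goal_cases)
    case (5 a)
    then have "{u \<in> fst a. u < snd a} = {u \<in> \<tau>. u < snd a}" "insert (snd a) \<tau> = fst a"
      by auto
    then show ?case
      by (auto simp: vsign_def split: prod.splits)
  qed (use K in \<open>auto simp: insert_absorb dest: subsetD[OF K]\<close>)
  also have "\<dots> = bd ?V c \<tau>"
    unfolding bd_def using fin c
    by (intro sum.mono_neutral_left) (auto simp: chains_def)
  finally show "boundary ?K c \<tau> = bd ?V c \<tau>" .
qed

lemma homology_VR_trivial:
  assumes "exact TYPE('f::field) (mspace Y) (\<lambda>x y. mdist Y x y \<le> r) (mspace Y) (Suc k)"
  shows "vcarrier (homology (VR_complex Y r) k :: ('f, _) vspace) = {boundaries (VR_complex Y r) k}"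
proof -
  have "0 \<in> (cycles (VR_complex Y r) k :: ('a set \<Rightarrow> 'f) set)"
    using boundary_VR_complex[of 0 k] by (simp add: cycles_def chains_VR_complex)
  then have "vcarrier (homology (VR_complex Y r) k :: ('f, _) vspace) \<noteq> {}"
    by (auto simp: homology_def)
  moreover have "vcarrier (homology (VR_complex Y r) k :: ('f, _) vspace) \<subseteq> {boundaries (VR_complex Y r) k}"
    by (rule homology_trivial[OF chains_VR_complex chains_VR_complex boundary_VR_complex
          boundary_VR_complex assms])
  ultimately show ?thesis by blast
qed

end

section \<open>The fundamental cycle of the cross-polytope\<close>

text \<open>Iterated suspension: each pair \<open>y n\<close>, \<open>z n\<close> is a 0-sphere
  joined to the cycle built so far.\<close>

lemma cross_polytope_cycle_exists:
  fixes y z :: "nat \<Rightarrow> 'a::linorder"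
  assumes V: "finite V" "y ` {..<m} \<subseteq> V" "z ` {..<m} \<subseteq> V"
    and inj: "inj_on y {..<m}" "inj_on z {..<m}" "y ` {..<m} \<inter> z ` {..<m} = {}"
    and E: "\<And>u v i j. u \<in> {y i, z i} \<Longrightarrow> v \<in> {y j, z j} \<Longrightarrow> i < m \<Longrightarrow> j < m \<Longrightarrow> i \<noteq> j \<Longrightarrow> E u v"
  shows "\<exists>c :: 'a set \<Rightarrow> 'f::field. c \<in> clique_chains V E m \<and> bd V c = 0 \<and> c (y ` {..<m}) \<noteq> 0"
proof -
  have "\<exists>c :: 'a set \<Rightarrow> 'f. c \<in> clique_chains (y ` {..<n} \<union> z ` {..<n}) E n \<and> bd V c = 0 \<and> c (y ` {..<n}) \<noteq> 0"
    if "n \<le> m" for n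
    using that
  proof (induction n)
    case 0
    \<comment> \<open>The empty simplex is the fundamental cycle of the sphere of dimension
      -1.\<close>
    let ?c = "\<lambda>\<sigma>::'a set. if \<sigma> = {} then 1 else (0::'f)"
    have "bd V ?c = 0"
      by (auto simp: bd_def fun_eq_iff)
    then show ?case
      by (intro exI[of _ ?c]) (auto simp: clique_chains_def)
  next
    case (Suc n)
    let ?L = "y ` {..<n} \<union> z ` {..<n}" and ?W = "y ` {..<Suc n} \<union> z ` {..<Suc n}"
    obtain c :: "'a set \<Rightarrow> 'f" where
      c: "c \<in> clique_chains ?L E n" "bd V c = 0" "c (y ` {..<n}) \<noteq> 0"
      using Suc.IH Suc_leD[OF Suc.prems] by blast
    have "y n \<notin> y ` {..<n}" "z n \<notin> z ` {..<n}"
      using inj_onD[OF inj(1), of n] inj_onD[OF inj(2), of n] Suc.prems by fastforce+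
    moreover have "y n \<notin> z ` {..<Suc n}" "z n \<notin> y ` {..<Suc n}"
      using inj(3) Suc.prems by (force simp: less_Suc_eq_le)+
    ultimately have notin: "y n \<notin> ?L" "z n \<notin> ?L" "z n \<notin> y ` {..<Suc n}" "y n \<notin> y ` {..<n}"
      by auto
    have adj: "\<forall>u\<in>?L. E u v \<and> E v u" if "v \<in> {y n, z n}" for v
    proof
      fix u assume "u \<in> ?L"
      then obtain i where "i < n" "u \<in> {y i, z i}"
        by auto
      then show "E u v \<and> E v u"
        using E[of u i v n] E[of v n u i] that Suc.prems by simp
    qed
    \<comment> \<open>Both cones have boundary \<open>c\<close>, so their difference is a
      cycle.\<close>
    let ?d = "cone_chain (y n) c - cone_chain (z n) c"
    have L: "?L \<subseteq> V" "y n \<in> V" "z n \<in> V"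
      using V Suc.prems by (auto simp: image_subset_iff)
    have "?d \<in> clique_chains ?W E (Suc n)"
      using notin c(1) adj
      by (intro clique_chains_diff cone_chain_clique_chains[where L = ?L]) auto
    moreover have "bd V ?d = 0"
      using bd_cone_chain[OF V(1) L(2) c(1) L(1) notin(1)] bd_cone_chain[OF V(1) L(3) c(1) L(1) notin(2)] c(2)
      by (simp add: bd_diff)
    moreover have "?d (y ` {..<Suc n}) \<noteq> 0"
    proof -
      have "y ` {..<Suc n} - {y n} = y ` {..<n}"
        using notin(4) by (simp add: lessThan_Suc)
      then show ?thesis
        using notin c(3) by (simp add: cone_chain_def)
    qed
    ultimately show ?case by blast
  qed
  from this[of m] show ?thesis
    using clique_chains_mono[of "y ` {..<m} \<union> z ` {..<m}" V] V by blast
qed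

text \<open>A clique contains at most one vertex of each antipodal pair, so the pair index
  \<open>p\<close> is injective on it; with \<open>m\<close> vertices it meets every pair.\<close>

lemma cross_polytope_clique:
  assumes V: "V = y ` {..<m} \<union> z ` {..<m}"
    and E: "\<And>i. i < m \<Longrightarrow> y i \<noteq> z i \<and> \<not> E (y i) (z i)"
    and \<sigma>: "\<sigma> \<subseteq> V" "pairwise E \<sigma>"
  shows "card \<sigma> \<le> m"
    and "card \<sigma> = m \<Longrightarrow> i < m \<Longrightarrow> y i \<in> \<sigma> \<or> z i \<in> \<sigma>"
proof -
  define p where "p v = (SOME i. i < m \<and> (v = y i \<or> v = z i))" for v
  have p: "p v < m \<and> (v = y (p v) \<or> v = z (p v))" if "v \<in> \<sigma>" for v
  proof -
    have "\<exists>i. i < m \<and> (v = y i \<or> v = z i)"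
      using that \<sigma> V by auto
    then show ?thesis
      unfolding p_def by (rule someI_ex)
  qed
  have inj: "inj_on p \<sigma>"
  proof (rule inj_onI)
    fix u v assume uv: "u \<in> \<sigma>" "v \<in> \<sigma>" "p u = p v"
    then show "u = v"
      using p[of u] p[of v] E[of "p u"] \<sigma>(2) unfolding pairwise_def by metis
  qed
  have sub: "p ` \<sigma> \<subseteq> {..<m}"
    using p by auto
  show "card \<sigma> \<le> m"
    using card_inj_on_le[OF inj sub] by simp
  assume "card \<sigma> = m" "i < m"
  then have "p ` \<sigma> = {..<m}"
    using sub card_image[OF inj] by (intro card_subset_eq) auto
  then show "y i \<in> \<sigma> \<or> z i \<in> \<sigma>"
    using p \<open>i < m\<close> by (metis imageE lessThan_iff)
qed

text \<open>
  In a cycle, the coefficients of two facets sharing all but one of their vertices determine each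
  other, and any facet can be moved to \<open>y ` {..<m}\<close> by exchanging antipodes one at a time.
\<close>

lemma cross_polytope_cycle_unique:
  fixes y z :: "nat \<Rightarrow> 'a::linorder" and c :: "'a set \<Rightarrow> 'f::field"
  assumes V: "V = y ` {..<m} \<union> z ` {..<m}"
    and E: "\<And>i. i < m \<Longrightarrow> y i \<noteq> z i \<and> \<not> E (y i) (z i) \<and> \<not> E (z i) (y i)"
    and c: "c \<in> clique_chains V E m" "bd V c = 0" "c (y ` {..<m}) = 0"
  shows "c = 0"
proof -
  have fin: "finite V" using V by simp
  note clique = cross_polytope_clique[OF V, of E]
  have "c \<sigma> = 0" for \<sigma>
  proof (induction "card (\<sigma> - y ` {..<m})" arbitrary: \<sigma> rule: less_induct)
    case less
    show ?case
    proof (rule ccontr)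
      assume nz: "c \<sigma> \<noteq> 0"
      note \<sigma> = clique_chainsD[OF c(1) nz]
      have f\<sigma>: "finite \<sigma>"
        using \<sigma> fin finite_subset by blast
      have "\<sigma> \<noteq> y ` {..<m}"
        using nz c(3) by auto
      moreover have "card (y ` {..<m}) \<le> m"
        using card_image_le[of "{..<m}" y] by simp
      ultimately have "\<not> \<sigma> \<subseteq> y ` {..<m}"
        using \<sigma>(2) by (metis card_seteq finite_imageI finite_lessThan)
      then obtain i where i: "i < m" "z i \<in> \<sigma>" "z i \<notin> y ` {..<m}"
        using \<sigma>(1) V by blast
      define \<tau> where "\<tau> = \<sigma> - {z i}"
      have yi: "y i \<notin> \<sigma>" "y i \<notin> \<tau>" "y i \<noteq> z i"
        using E[OF i(1)] \<sigma>(3) i(2) by (auto simp: pairwise_def \<tau>_def)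
      have card\<tau>: "Suc (card \<tau>) = m"
        using f\<sigma> i(2) \<sigma>(2) unfolding \<tau>_def by (metis card_Suc_Diff1)
      \<comment> \<open>Such a set misses the pair \<open>i\<close> entirely, so it is no clique on
        \<open>m\<close> vertices. Only two cofaces of \<open>\<tau>\<close> are left, and
        exchanging \<open>z i\<close> for \<open>y i\<close> links their coefficients.\<close>
      have "c (insert u \<tau>) = 0" if u: "u \<in> V - \<tau>" "u \<noteq> y i" "u \<noteq> z i" for u
      proof (rule ccontr)
        assume "c (insert u \<tau>) \<noteq> 0"
        note D = clique_chainsD[OF c(1) this]
        have "y i \<in> insert u \<tau> \<or> z i \<in> insert u \<tau>"
          using E i(1) D by (intro clique(2)) auto
        then show False
          using u yi by (auto simp: \<tau>_def)
      qed
      then have "bd V c \<tau> = (\<Sum>u\<in>{y i, z i}. vsign u \<tau> * c (insert u \<tau>))"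
        unfolding bd_def using fin V i yi by (intro sum.mono_neutral_right) (auto simp: \<tau>_def)
      then have "vsign (y i) \<tau> * c (insert (y i) \<tau>) + vsign (z i) \<tau> * c \<sigma> = 0"
        using c(2) yi i(2) by (simp add: \<tau>_def insert_absorb)
      moreover have "c (insert (y i) \<tau>) = 0"
      proof (rule less)
        have "insert (y i) \<tau> - y ` {..<m} \<subset> \<sigma> - y ` {..<m}"
          using i by (auto simp: \<tau>_def)
        then show "card (insert (y i) \<tau> - y ` {..<m}) < card (\<sigma> - y ` {..<m})"
          using f\<sigma> by (intro psubset_card_mono) auto
      qed
      ultimately show False
        using nz by simp
    qed
  qed
  then show ?thesis by (simp add: fun_eq_iff)
qed

section \<open>Persistence diagrams with one point\<close>

lemma interval_sum_single:
  "pspace (interval_sum [(b, d)] :: ('f::field, _) pmodule) r =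
    \<lparr>vcarrier = {f. \<forall>i. \<not> (i = 0 \<and> b \<le> r \<and> r < d) \<longrightarrow> f i = 0},
     vadd = (\<lambda>f g i. f i + g i), vscale = (\<lambda>a f i. a * f i)\<rparr>"
  "pmap (interval_sum [(b, d)] :: ('f, _) pmodule) r s f i =
    (if i = 0 \<and> b \<le> r \<and> r < d \<and> b \<le> s \<and> s < d then f i else 0)"
proof -
  have A: "{i. i < length [(b, d)] \<and> fst ([(b, d)] ! i) \<le> r \<and> r < snd ([(b, d)] ! i)}
      = {i. i = 0 \<and> b \<le> r \<and> r < d}" for r
    by auto
  show "pspace (interval_sum [(b, d)] :: ('f, _) pmodule) r =
    \<lparr>vcarrier = {f. \<forall>i. \<not> (i = 0 \<and> b \<le> r \<and> r < d) \<longrightarrow> f i = 0},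
     vadd = (\<lambda>f g i. f i + g i), vscale = (\<lambda>a f i. a * f i)\<rparr>"
    unfolding interval_sum_def A Let_def by simp
  show "pmap (interval_sum [(b, d)] :: ('f, _) pmodule) r s f i =
    (if i = 0 \<and> b \<le> r \<and> r < d \<and> b \<le> s \<and> s < d then f i else 0)"
    unfolding interval_sum_def A Let_def by auto
qed

text \<open>Inside the interval the module is one-dimensional and so has two distinct elements,
  whereas exactness would leave a single class.\<close>

lemma VR_dgm_single:
  fixes Y :: "'a::linorder metric"
  assumes fin: "finite (mspace Y)" and dgm: "is_VR_dgm TYPE('f::field) Y k {#(b, d)#}"
  shows "0 \<le> b" "b < d"
    and "b \<le> r \<Longrightarrow> r < d \<Longrightarrow>
      \<not> exact TYPE('f) (mspace Y) (\<lambda>x y. mdist Y x y \<le> r) (mspace Y) (Suc k)"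
proof -
  obtain I where I: "mset I = {#(b, d)#}" "\<forall>(b, d)\<in>set I. 0 \<le> b \<and> b < d"
    "pmodule_isomorphic (VR_pmodule Y k :: ('f, ('a set \<Rightarrow> 'f) set) pmodule)
       (interval_sum I :: ('f, nat \<Rightarrow> 'f) pmodule)"
    using dgm unfolding is_VR_dgm_def by blast
  have "I = [(b, d)]"
    using I(1) by simp
  with I(2) show bd: "0 \<le> b" "b < d"
    by auto
  assume r: "b \<le> r" "r < d"
  obtain \<phi> where "\<And>r. 0 \<le> r \<Longrightarrow>
      vspace_iso (pspace (VR_pmodule Y k :: ('f, ('a set \<Rightarrow> 'f) set) pmodule) r)
        (pspace (interval_sum [(b, d)] :: ('f, nat \<Rightarrow> 'f) pmodule) r) (\<phi> r)"
    using I(3) unfolding pmodule_isomorphic_def \<open>I = [(b, d)]\<close> by blast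
  from this[of r] have bij: "bij_betw (\<phi> r)
      (vcarrier (homology (VR_complex Y r) k :: ('f, _) vspace))
      {f :: nat \<Rightarrow> 'f. \<forall>i. i \<noteq> 0 \<longrightarrow> f i = 0}"
    using r bd by (simp add: vspace_iso_def VR_pmodule_def interval_sum_single)
  show "\<not> exact TYPE('f) (mspace Y) (\<lambda>x y. mdist Y x y \<le> r) (mspace Y) (Suc k)"
  proof
    assume "exact TYPE('f) (mspace Y) (\<lambda>x y. mdist Y x y \<le> r) (mspace Y) (Suc k)"
    then have "vcarrier (homology (VR_complex Y r) k :: ('f, _) vspace) = {boundaries (VR_complex Y r) k}"
      using r bd by (intro homology_VR_trivial[OF fin]) auto
    then have "{f :: nat \<Rightarrow> 'f. \<forall>i. i \<noteq> 0 \<longrightarrow> f i = 0} =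
        {\<phi> r (boundaries (VR_complex Y r) k)}"
      using bij_betw_imp_surj_on[OF bij] by simp
    moreover have "(\<lambda>i. 0) \<in> {f :: nat \<Rightarrow> 'f. \<forall>i. i \<noteq> 0 \<longrightarrow> f i = 0}"
      "(\<lambda>i. if i = 0 then 1 else 0) \<in> {f :: nat \<Rightarrow> 'f. \<forall>i. i \<noteq> 0 \<longrightarrow> f i = 0}"
      by auto
    ultimately have "(\<lambda>i::nat. 0) = (\<lambda>i. if i = 0 then 1 else (0 :: 'f))"
      by (metis singletonD)
    from fun_cong[OF this, of 0] show False
      by simp
  qed
qed

text \<open>For scales in \<open>[tb, td)\<close> the complex is the boundary of a cross-polytope,
  with one-dimensional top homology. The attained distance \<open>tb\<close> prevents an earlier
  birth, and at \<open>td\<close> the complex becomes a full simplex.\<close>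

lemma VR_dgm_cross_polytope:
  fixes Y :: "'a::linorder metric" and y z :: "nat \<Rightarrow> 'a"
  assumes V: "mspace Y = y ` {..<Suc k} \<union> z ` {..<Suc k}"
    and inj: "inj_on y {..<Suc k}" "inj_on z {..<Suc k}" "y ` {..<Suc k} \<inter> z ` {..<Suc k} = {}"
    and opp: "\<And>i. i < Suc k \<Longrightarrow> mdist Y (y i) (z i) = td"
    and near: "\<And>i j u v. i < Suc k \<Longrightarrow> j < Suc k \<Longrightarrow> i \<noteq> j \<Longrightarrow>
       u \<in> {y i, z i} \<Longrightarrow> v \<in> {y j, z j} \<Longrightarrow> mdist Y u v \<le> tb"
    and attained: "i\<^sub>0 < Suc k" "j\<^sub>0 < Suc k" "i\<^sub>0 \<noteq> j\<^sub>0" "mdist Y (y i\<^sub>0) (y j\<^sub>0) = tb"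
    and t: "0 \<le> tb" "tb < td"
  shows "is_VR_dgm TYPE('f::field) Y k {#(tb, td)#}"
proof -
  let ?V = "mspace Y"
  let ?E = "\<lambda>r x y. mdist Y x y \<le> r"
  let ?K = "VR_complex Y"
  define \<sigma>\<^sub>0 where "\<sigma>\<^sub>0 = y ` {..<Suc k}"
  have fin: "finite ?V"
    using V by simp
  have yz_in: "y i \<in> ?V" "z i \<in> ?V" if "i < Suc k" for i
    using that V by auto
  have yz_ne: "y i \<noteq> z i" if "i < Suc k" for i
    using that inj(3) by auto
  have opp': "mdist Y (z i) (y i) = td" if "i < Suc k" for i
    using opp[OF that] by (simp only: mdist_commute[of Y "z i"])
  have index: "\<exists>i < Suc k. u \<in> {y i, z i}" if "u \<in> ?V" for u
    using that unfolding V by auto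
  have dist_cases: "mdist Y u v \<le> tb \<or> mdist Y u v = td" if uv: "u \<in> ?V" "v \<in> ?V" for u v
  proof -
    obtain i j where ij: "i < Suc k" "j < Suc k" "u \<in> {y i, z i}" "v \<in> {y j, z j}"
      using index[OF uv(1)] index[OF uv(2)] by metis
    consider "i \<noteq> j" | "u = v" | "u = y i" "v = z i" | "u = z i" "v = y i"
      using ij(3,4) by blast
    then show ?thesis
    proof cases
      case 1
      then show ?thesis
        using near[OF ij(1,2) _ ij(3,4)] by simp
    next
      case 2
      then have "mdist Y u v = 0"
        using uv(1) by (simp add: Metric_space.mdist_zero[OF Metric_space_mspace_mdist])
      then show ?thesis
        using t by simp
    qed (use opp opp' ij(1) in simp_all)
  qed
  have not_adj: "y i \<noteq> z i \<and> \<not> ?E r (y i) (z i) \<and> \<not> ?E r (z i) (y i)"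
    if "i < Suc k" "r < td" for i r
    using opp[OF that(1)] opp'[OF that(1)] that(2) yz_ne[OF that(1)] by simp
  \<comment> \<open>Before \<open>td\<close> no simplex contains an antipodal pair, so there are no
    boundaries in degree \<open>k\<close> and homology classes are single cycles.\<close>
  have no_big: "chains (?K r) (Suc k) = {0 :: 'a set \<Rightarrow> 'f}" if "0 \<le> r" "r < td" for r
  proof -
    have "c = 0" if c: "c \<in> clique_chains ?V (?E r) (Suc (Suc k))" for c :: "'a set \<Rightarrow> 'f"
    proof -
      have "c \<sigma> = 0" for \<sigma>
      proof (rule ccontr)
        assume "c \<sigma> \<noteq> 0"
        note D = clique_chainsD[OF c this]
        have "card \<sigma> \<le> Suc k"
          using not_adj \<open>r < td\<close> by (intro cross_polytope_clique(1)[OF V _ D(1,3)]) auto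
        then show False
          using D(2) by simp
      qed
      then show ?thesis by (simp add: fun_eq_iff)
    qed
    then show ?thesis
      using clique_chains_zero by (auto simp: chains_VR_complex[OF fin that(1)])
  qed
  have B: "boundaries (?K r) k = {0 :: 'a set \<Rightarrow> 'f}" if "0 \<le> r" "r < td" for r
  proof -
    have "(0 :: 'a set \<Rightarrow> 'f) \<in> chains (?K r) k"
      by (simp add: chains_VR_complex[OF fin that(1)])
    from boundary_VR_complex[OF fin that(1) this] have "boundary (?K r) 0 = (0 :: 'a set \<Rightarrow> 'f)"
      by simp
    then show ?thesis
      by (simp add: boundaries_def no_big[OF that])
  qed
  have same: "?K r = ?K tb" if "tb \<le> r" "r < td" for r
  proof -
    have "?E r u v \<longleftrightarrow> ?E tb u v" if "u \<in> ?V" "v \<in> ?V" for u v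
      using dist_cases[OF that] \<open>tb \<le> r\<close> \<open>r < td\<close> t by auto
    then show ?thesis
      unfolding set_eq_iff VR_complex_iff[OF fin] by (meson subsetD)
  qed
  define Z :: "('a set \<Rightarrow> 'f) set" where
    "Z = {c \<in> clique_chains ?V (?E tb) (Suc k). bd ?V c = 0}"
  have Z: "cycles (?K tb) k = Z"
    using boundary_VR_complex[OF fin t(1), of _ k] chains_VR_complex[OF fin t(1), of k]
    by (auto simp: cycles_def Z_def)
  have hom: "homology (?K r) k = \<lparr>vcarrier = (\<lambda>c. {c}) ` Z, vadd = (\<lambda>x y. x + y),
      vscale = (\<lambda>a x. (\<lambda>z \<sigma>. a * z \<sigma>) ` x + {0})\<rparr>" if "tb \<le> r" "r < td" for r
    using B[of tb] t by (simp add: homology_def same[OF that] Z elt_set_plus_def)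
  have Z_add: "c + c' \<in> Z" "c - c' \<in> Z" if "c \<in> Z" "c' \<in> Z" for c c'
    using that clique_chains_add clique_chains_diff by (auto simp: Z_def bd_add bd_diff)
  have Z_scale: "(\<lambda>\<sigma>. a * c \<sigma>) \<in> Z" if "c \<in> Z" for c a
    using that clique_chains_scale by (auto simp: Z_def bd_scale)
  have Z_inj: "c = c'" if "c \<in> Z" "c' \<in> Z" "c \<sigma>\<^sub>0 = c' \<sigma>\<^sub>0" for c c'
  proof -
    have "c - c' = 0"
    proof (rule cross_polytope_cycle_unique[OF V, of "?E tb"])
      show "c - c' \<in> clique_chains ?V (?E tb) (Suc k)" "bd ?V (c - c') = 0"
        using Z_add(2)[OF that(1,2)] by (auto simp: Z_def)
    qed (use not_adj t that in \<open>auto simp: \<sigma>\<^sub>0_def\<close>)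
    then show ?thesis by simp
  qed
  obtain c\<^sub>0 where c\<^sub>0: "c\<^sub>0 \<in> Z" "c\<^sub>0 \<sigma>\<^sub>0 \<noteq> 0"
  proof -
    have "\<exists>c :: 'a set \<Rightarrow> 'f. c \<in> clique_chains ?V (?E tb) (Suc k) \<and> bd ?V c = 0 \<and> c (y ` {..<Suc k}) \<noteq> 0"
    proof (rule cross_polytope_cycle_exists[OF fin _ _ inj])
      show "?E tb u v" if "u \<in> {y i, z i}" "v \<in> {y j, z j}" "i < Suc k" "j < Suc k" "i \<noteq> j" for u v i j
        using near that by blast
    qed (use V in auto)
    then show ?thesis
      using that by (auto simp: Z_def \<sigma>\<^sub>0_def)
  qed
  \<comment> \<open>The vertex \<open>y i\<^sub>0\<close> is never uniquely antipodal here: from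
    \<open>td\<close> on it is an apex, and below \<open>tb\<close> it has the two non-neighbours
    \<open>y j\<^sub>0\<close> and \<open>z i\<^sub>0\<close>.\<close>
  have triv: "vcarrier (homology (?K r) k :: ('f, _) vspace) = {boundaries (?K r) k}"
    if r: "0 \<le> r" "r < tb \<or> td \<le> r" for r
  proof (rule homology_VR_trivial[OF fin r(1)])
    let ?N = "{u \<in> ?V - {y i\<^sub>0}. \<not> (?E r u (y i\<^sub>0) \<and> ?E r (y i\<^sub>0) u)}"
    have "card ?N \<noteq> 1"
    proof (cases "td \<le> r")
      case True
      have "?E r u v" if "u \<in> ?V" "v \<in> ?V" for u v
        using dist_cases[OF that] True t by auto
      then have "?N = {}"
        using yz_in(1)[OF attained(1)] by blast
      then show ?thesis
        by (metis card.empty zero_neq_one)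
    next
      case False
      have "y i\<^sub>0 \<noteq> y j\<^sub>0" "y j\<^sub>0 \<noteq> z i\<^sub>0"
        using inj attained by (auto simp: inj_on_eq_iff)
      moreover have "{y j\<^sub>0, z i\<^sub>0} \<subseteq> ?N"
        using False r attained yz_in not_adj[of i\<^sub>0 r] calculation by auto
      then have "card {y j\<^sub>0, z i\<^sub>0} \<le> card ?N"
        using fin by (intro card_mono) auto
      ultimately show ?thesis
        by simp
    qed
    moreover have "card ?V \<le> 2 * Suc k"
      unfolding V using card_Un_le[of "y ` {..<Suc k}" "z ` {..<Suc k}"]
        card_image_le[of "{..<Suc k}" y] card_image_le[of "{..<Suc k}" z] by simp
    ultimately show "exact TYPE('f) ?V (?E r) ?V (Suc k)"
      using fin yz_in(1)[OF attained(1)] by (intro exact_if_not_antipodal) auto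
  qed
  \<comment> \<open>The coordinate of a class is the coefficient of its only cycle at the facet
    \<open>\<sigma>\<^sub>0\<close>: injective by \<open>Z_inj\<close>, surjective by scaling
    \<open>c\<^sub>0\<close>.\<close>
  define \<phi> :: "real \<Rightarrow> ('a set \<Rightarrow> 'f) set \<Rightarrow> nat \<Rightarrow> 'f" where
    "\<phi> r x = (\<lambda>i. if i = 0 \<and> tb \<le> r \<and> r < td then the_elem x \<sigma>\<^sub>0 else 0)" for r x
  let ?M = "VR_pmodule Y k :: ('f, ('a set \<Rightarrow> 'f) set) pmodule"
  let ?I = "interval_sum [(tb, td)] :: ('f, nat \<Rightarrow> 'f) pmodule"
  have iso: "vspace_iso (pspace ?M r) (pspace ?I r) (\<phi> r)" if r: "0 \<le> r" for r
  proof (cases "tb \<le> r \<and> r < td")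
    case True
    have "bij_betw (\<phi> r) ((\<lambda>c. {c}) ` Z) {f. \<forall>i. i \<noteq> 0 \<longrightarrow> f i = 0}"
    proof (rule bij_betwI')
      fix x x' assume "x \<in> (\<lambda>c. {c}) ` Z" "x' \<in> (\<lambda>c. {c}) ` Z"
      then show "\<phi> r x = \<phi> r x' \<longleftrightarrow> x = x'"
        using Z_inj True by (auto simp: \<phi>_def fun_eq_iff)
    next
      fix f :: "nat \<Rightarrow> 'f" assume f: "f \<in> {f. \<forall>i. i \<noteq> 0 \<longrightarrow> f i = 0}"
      have "f = \<phi> r {\<lambda>\<sigma>. f 0 / c\<^sub>0 \<sigma>\<^sub>0 * c\<^sub>0 \<sigma>}"
        using f True c\<^sub>0(2) by (auto simp: \<phi>_def fun_eq_iff)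
      then show "\<exists>x \<in> (\<lambda>c. {c}) ` Z. f = \<phi> r x"
        using Z_scale[OF c\<^sub>0(1)] by blast
    qed (auto simp: \<phi>_def)
    moreover have "{c} + {c'} = {c + c'}" for c c' :: "'a set \<Rightarrow> 'f"
      by (auto simp: set_plus_def)
    ultimately show ?thesis
      using True
      by (auto simp: vspace_iso_def VR_pmodule_def interval_sum_single hom \<phi>_def fun_eq_iff)
  next
    case False
    then have "vcarrier (homology (?K r) k :: ('f, _) vspace) = {boundaries (?K r) k}"
      by (intro triv r) auto
    moreover have "\<phi> r x = (\<lambda>i. 0)" for x
      using False by (auto simp: \<phi>_def)
    moreover have "{f :: nat \<Rightarrow> 'f. \<forall>i. f i = 0} = {\<lambda>i. 0}"
      by auto
    ultimately show ?thesis
      using False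
      by (simp add: vspace_iso_def VR_pmodule_def interval_sum_single bij_betw_def)
  qed
  have natural: "\<phi> s (pmap ?M r s x) = pmap ?I r s (\<phi> r x)"
    if rs: "0 \<le> r" "r \<le> s" and x: "x \<in> vcarrier (pspace ?M r)" for r s x
  proof (cases "tb \<le> s \<and> s < td")
    case True
    have "pmap ?M r s x = x"
    proof -
      have "x + {0} = x"
        by (simp add: set_plus_def)
      moreover have "boundaries (?K s) k = {0 :: 'a set \<Rightarrow> 'f}"
        using True t(1) by (intro B) auto
      ultimately show ?thesis
        by (simp add: VR_pmodule_def homology_map_def)
    qed
    \<comment> \<open>Classes from before \<open>tb\<close> must map to 0, as they do in the
      interval module.\<close>
    moreover have "the_elem x \<sigma>\<^sub>0 = 0" if "r < tb"
    proof -
      have "x \<in> {boundaries (?K r) k}"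
        using x triv[OF rs(1)] that by (simp add: VR_pmodule_def)
      then have "x = {0}"
        using B[OF rs(1)] that t by simp
      then show ?thesis by simp
    qed
    ultimately show ?thesis
      using True rs by (auto simp: \<phi>_def interval_sum_single fun_eq_iff)
  next
    case False
    then show ?thesis
      by (auto simp: \<phi>_def interval_sum_single fun_eq_iff)
  qed
  have "pmodule_isomorphic ?M ?I"
    unfolding pmodule_isomorphic_def
    by (rule exI[of _ \<phi>]) (simp add: iso natural)
  then have "mset [(tb, td)] = {#(tb, td)#} \<and> (\<forall>(b, d)\<in>set [(tb, td)]. 0 \<le> b \<and> b < d) \<and>
      pmodule_isomorphic ?M ?I"
    using t by simp
  then show ?thesis
    unfolding is_VR_dgm_def by (rule exI)
qed

section \<open>Configurations on the circle\<close>

text \<open>The antipode map \<open>g\<close> is an involution with pairwise crossing chords, hence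
  the shift by \<open>k + 1\<close> in cyclic order. Summing the \<open>2 * k + 2\<close> arcs of
  \<open>k\<close> steps, each at most \<open>r\<close>, gives the bound.\<close>

lemma antipodal_circle_scale:
  fixes S :: "real set"
  assumes S: "finite S" "S \<subseteq> {0..<2 * pi}" "card S = 2 * k + 2"
    and r: "0 \<le> r"
    and opp: "\<And>v. v \<in> S \<Longrightarrow> card {u \<in> S - {v}. \<not> min \<bar>u - v\<bar> (2 * pi - \<bar>u - v\<bar>) \<le> r} = 1"
  shows "real k / (real k + 1) * pi \<le> r"
proof -
  define far where "far u v \<longleftrightarrow> r < \<bar>u - v\<bar> \<and> r < 2 * pi - \<bar>u - v\<bar>" for u v :: real
  have "\<exists>u. {u \<in> S - {v}. far u v} = {u}" if "v \<in> S" for v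
    using opp[OF that] by (simp add: card_1_singleton_iff far_def not_le)
  then obtain g where g: "\<And>v. v \<in> S \<Longrightarrow> {u \<in> S - {v}. far u v} = {g v}"
    by metis
  have gS: "g v \<in> S" "g v \<noteq> v" "far (g v) v" if "v \<in> S" for v
    using g[OF that] by blast+
  have near: "\<not> far u v" if "v \<in> S" "u \<in> S" "u \<noteq> v" "u \<noteq> g v" for u v
    using g[OF that(1)] that by blast
  have far_sym: "far u v \<longleftrightarrow> far v u" for u v
    by (simp add: far_def abs_minus_commute)
  have gg: "g (g v) = v" if "v \<in> S" for v
    using near[of "g v" v] gS[OF that] gS(1) far_sym that by metis
  have bounds: "0 \<le> v \<and> v < 2 * pi" if "v \<in> S" for v
    using that S by auto
  \<comment> \<open>Both arcs between \<open>x\<close> and \<open>g x\<close> are shorter than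
    \<open>2 * pi - r\<close>. If one contained \<open>y\<close> and \<open>g y\<close>, the subarc
    from \<open>x\<close> to the farther of them would have length at most \<open>r\<close>, being
    spanned by a near pair, and would make \<open>y\<close> and \<open>g y\<close> near.\<close>
  have cross: "(x < y \<and> y < g x) \<longleftrightarrow> \<not> (x < g y \<and> g y < g x)"
    if "x \<in> S" "y \<in> S" "y \<noteq> x" "y \<noteq> g x" "x < g x" for x y
  proof -
    have ne: "g y \<noteq> x" "g y \<noteq> g x" "g y \<noteq> y"
      using that gg gS by metis+
    have "\<not> far x y" "\<not> far x (g y)" "\<not> far (g x) y" "\<not> far (g x) (g y)"
      using that near gS ne gg by metis+
    then show ?thesis
      using gS(3)[OF that(1)] gS(3)[OF that(2)] bounds[OF that(1)] bounds[OF that(2)]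
        bounds[OF gS(1)[OF that(1)]] bounds[OF gS(1)[OF that(2)]] ne that
      unfolding far_def by (simp add: abs_if split: if_splits)
  qed
  \<comment> \<open>By crossing, \<open>g\<close> exchanges the two sides of the chord, so each
    holds half of the other \<open>2 * k\<close> points.\<close>
  have count: "card {y \<in> S. x < y \<and> y < g x} = k" if x: "x \<in> S" "x < g x" for x
  proof -
    let ?A = "{y \<in> S. x < y \<and> y < g x}" and ?B = "{y \<in> S. y \<noteq> x \<and> y \<noteq> g x \<and> \<not> (x < y \<and> y < g x)}"
    have inj: "inj_on g T" if "T \<subseteq> S" for T
      using gg that by (metis inj_on_def subsetD)
    have ne: "g y \<noteq> x \<and> g y \<noteq> g x" if "y \<in> S" "y \<noteq> x" "y \<noteq> g x" for y
      using that gg x by metis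
    have "g ` ?A \<subseteq> ?B"
      using cross[OF x(1) _ _ _ x(2)] ne gS(1) by fastforce
    then have "card ?A \<le> card ?B"
      using S(1) by (intro card_inj_on_le[OF inj]) auto
    moreover have "g ` ?B \<subseteq> ?A"
      using cross[OF x(1) _ _ _ x(2)] ne gS(1) by fastforce
    then have "card ?B \<le> card ?A"
      using S(1) by (intro card_inj_on_le[OF inj]) auto
    moreover have "card (?A \<union> ?B) = card ?A + card ?B"
      using S(1) by (intro card_Un_disjoint) auto
    moreover have "?A \<union> ?B = S - {x, g x}"
      using x by auto
    moreover have "card (S - {x, g x}) = card S - 2"
      using x gS[OF x(1)] S(1) by (subst card_Diff_subset) auto
    ultimately show ?thesis
      using S(3) by simp
  qed

  define X where "X i = sorted_list_of_set S ! i" for i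
  have len: "length (sorted_list_of_set S) = 2 * k + 2"
    using S by simp
  have X_less: "X i < X j" if "i < j" "j < 2 * k + 2" for i j
    unfolding X_def using that len strict_sorted_list_of_set[of S]
    by (auto intro: sorted_wrt_nth_less)
  have X_less_iff: "X i < X j \<longleftrightarrow> i < j" if "i < 2 * k + 2" "j < 2 * k + 2" for i j
    using X_less that by (metis linorder_neqE_nat order_less_asym order_less_irrefl)
  have S_eq: "S = X ` {..<2 * k + 2}"
  proof -
    have "S = set (sorted_list_of_set S)"
      using S(1) by simp
    then show ?thesis
      unfolding X_def set_conv_nth len by auto
  qed
  have XS: "X i \<in> S" if "i < 2 * k + 2" for i
    using that S_eq by auto
  have step: "j = i + k + 1" if ij: "i < j" "j < 2 * k + 2" "g (X i) = X j" for i j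
  proof -
    have "{y \<in> S. X i < y \<and> y < g (X i)} = X ` {i<..<j}"
      unfolding ij(3) using ij(1,2) X_less_iff by (auto simp: S_eq)
    moreover have "inj_on X {i<..<j}"
    proof (rule inj_onI)
      fix a b assume "a \<in> {i<..<j}" "b \<in> {i<..<j}" "X a = X b"
      then show "a = b"
        using X_less_iff[of a b] X_less_iff[of b a] ij(2) by simp
    qed
    ultimately have "j - i - 1 = k"
      using count[of "X i"] XS[of i] X_less[OF ij(1,2)] ij by (simp add: card_image)
    then show ?thesis
      using ij(1) by simp
  qed
  have opposite: "g (X i) = X (i + k + 1)" if i: "i \<le> k" for i
  proof -
    have "X i \<in> S"
      using i by (intro XS) simp
    then obtain j where j: "j < 2 * k + 2" "g (X i) = X j"
      using gS(1)[of "X i"] by (auto simp: S_eq)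
    then have "g (X j) = X i" "j \<noteq> i"
      using gg gS(2) \<open>X i \<in> S\<close> by metis+
    then show ?thesis
      using step[of i j] step[of j i] i j by (cases "i < j") auto
  qed
  have farX: "r < X (i + k + 1) - X i" "r < 2 * pi - (X (i + k + 1) - X i)" if "i \<le> k" for i
    using gS(3)[OF XS, of i] opposite[OF that] X_less[of i "i + k + 1"] that by (auto simp: far_def)
  have nearX: "X j - X i \<le> r \<or> 2 * pi - (X j - X i) \<le> r"
    if "i < j" "j < 2 * k + 2" "j \<noteq> i + k + 1" for i j
  proof -
    have "g (X i) \<noteq> X j"
      using step that by blast
    then have "\<not> far (X j) (X i)"
      using that X_less[of i j] XS by (intro near) auto
    then show ?thesis
      using X_less[of i j] that by (auto simp: far_def)
  qed
  \<comment> \<open>The \<open>k + 2\<close> arcs of \<open>k\<close> steps that do not pass 0. Each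
    lies inside an arc between antipodes, which rules out that its complement is the short
    side.\<close>
  have short: "X (i + k) - X i \<le> r" if "i < k + 2" for i
  proof (cases "k = 0")
    case True
    then show ?thesis
      using r by simp
  next
    case False
    have "r < 2 * pi - (X (i + k) - X i)"
    proof (cases "i \<le> k")
      case True
      then show ?thesis
        using farX(2)[OF True] X_less[of "i + k" "i + k + 1"] by simp
    next
      case False
      then have i: "i = k + 1"
        using that by simp
      show ?thesis
        using farX(2)[of k] X_less[of k "k + 1"] by (simp add: i add.commute)
    qed
    then show ?thesis
      using nearX[of i "i + k"] that False by fastforce
  qed
  \<comment> \<open>The \<open>k\<close> arcs of \<open>k\<close> steps through 0, from
    \<open>X (i + (k + 2))\<close> round to \<open>X i\<close>; the complement is too long, since it
    contains the arc from \<open>X i\<close> to its antipode.\<close>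
  have wrap: "2 * pi - (X (i + (k + 2)) - X i) \<le> r" if "i < k" for i
    using nearX[of i "i + (k + 2)"] farX(1)[of i] X_less[of "i + k + 1" "i + (k + 2)"] that by fastforce
  have "(\<Sum>i<k + 2. X (i + k) - X i) + (\<Sum>i<k. 2 * pi - (X (i + (k + 2)) - X i))
      \<le> (\<Sum>i<k + 2. r) + (\<Sum>i<k. r)"
    using short wrap by (intro add_mono sum_mono) auto
  \<comment> \<open>Each point is the start of one arc and the end of another, so everything cancels
    except one \<open>2 * pi\<close> per arc through 0.\<close>
  also have "(\<Sum>i<k + 2. X (i + k)) = X k + X (k + 1) + (\<Sum>i<k. X (i + (k + 2)))"
    by (simp add: sum.lessThan_Suc_shift del: sum.lessThan_Suc)
  then have "(\<Sum>i<k + 2. X (i + k) - X i) + (\<Sum>i<k. 2 * pi - (X (i + (k + 2)) - X i)) = 2 * pi * k"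
    by (simp add: sum_subtractf sum.distrib)
  finally have "2 * pi * k \<le> (2 * real k + 2) * r"
    by (simp add: algebra_simps)
  then show ?thesis
    by (simp add: field_simps)
qed

section \<open>Realizing configurations\<close>

text \<open>The points \<open>y\<close> form an arithmetic progression, and \<open>z\<close> is
  \<open>y\<close> rotated by \<open>td\<close>. Since \<open>tb < td \<le> pi\<close>, each
  \<open>z i\<close> falls between the points \<open>h\<close> and \<open>h + 1\<close> cyclic steps
  after \<open>y i\<close>, so the two families alternate.\<close>

lemma circle_antipodal_configuration:
  assumes h: "h \<ge> 1"
    and t: "2 * real h / (2 * real h + 1) * pi \<le> tb" "tb < td" "td \<le> pi"
  obtains y z :: "nat \<Rightarrow> real" where
    "y ` {..<Suc (2 * h)} \<subseteq> {0..<2 * pi}" "z ` {..<Suc (2 * h)} \<subseteq> {0..<2 * pi}"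
    "inj_on y {..<Suc (2 * h)}" "inj_on z {..<Suc (2 * h)}"
    "y ` {..<Suc (2 * h)} \<inter> z ` {..<Suc (2 * h)} = {}"
    "\<And>i. i < Suc (2 * h) \<Longrightarrow> min \<bar>y i - z i\<bar> (2 * pi - \<bar>y i - z i\<bar>) = td"
    "\<And>i j u v. i < Suc (2 * h) \<Longrightarrow> j < Suc (2 * h) \<Longrightarrow> i \<noteq> j \<Longrightarrow> u \<in> {y i, z i} \<Longrightarrow> v \<in> {y j, z j} \<Longrightarrow>
       min \<bar>u - v\<bar> (2 * pi - \<bar>u - v\<bar>) \<le> tb"
    "min \<bar>y 0 - y (Suc h)\<bar> (2 * pi - \<bar>y 0 - y (Suc h)\<bar>) = tb"
proof -
  \<comment> \<open>The step is chosen so that \<open>h + 1\<close> steps leave a complementary arc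
    of exactly \<open>tb\<close>; the lower bound on \<open>tb\<close> says precisely that
    \<open>h\<close> steps, of length \<open>H\<close>, do not exceed \<open>tb\<close>.\<close>
  define b where "b = (2 * pi - tb) / (real h + 1)"
  define H where "H = real h * b"
  define y where "y j = real j * b" for j :: nat
  define z where "z j = (if y j + td < 2 * pi then y j + td else y j + td - 2 * pi)" for j
  have "b > 0"
  proof -
    have "tb < 2 * pi"
      using t pi_gt_zero by linarith
    then show ?thesis
      by (simp add: b_def)
  qed
  moreover have "b \<le> H"
    using h \<open>b > 0\<close> by (simp add: H_def)
  moreover have "H \<le> tb"
    using t(1) by (simp add: H_def b_def field_simps)
  moreover have "(real h + 1) * b = 2 * pi - tb"
    by (simp add: b_def)
  then have "H + b = 2 * pi - tb"
    by (simp add: H_def algebra_simps)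
  ultimately have c: "0 < b" "b \<le> H" "H \<le> tb" "H + b = 2 * pi - tb" "tb < td" "td \<le> pi"
    using t by auto
  have range: "0 \<le> y j" "y j \<le> 2 * H" if "j < Suc (2 * h)" for j
  proof -
    show "0 \<le> y j"
      using c by (simp add: y_def)
    have "real j * b \<le> real (2 * h) * b"
      using c that by (intro mult_right_mono) auto
    then show "y j \<le> 2 * H"
      by (simp add: y_def H_def)
  qed
  have gap: "(b \<le> y j - y i \<and> y j - y i \<le> H) \<or> (2 * pi - tb \<le> y j - y i \<and> y j - y i \<le> 2 * H)"
    if "i < j" "j < Suc (2 * h)" for i j
  proof -
    have eq: "y j - y i = real (j - i) * b"
      using that by (simp add: y_def algebra_simps of_nat_diff)
    have "1 * b \<le> real (j - i) * b" "real (j - i) * b \<le> real (2 * h) * b"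
      using c that by (auto intro!: mult_right_mono simp: Suc_leI)
    moreover have "real (j - i) * b \<le> real h * b" if "j - i \<le> h"
      using c that by (intro mult_right_mono) auto
    moreover have "real (h + 1) * b \<le> real (j - i) * b" if "\<not> j - i \<le> h"
      using c that by (intro mult_right_mono) auto
    moreover have "real (h + 1) * b = 2 * pi - tb"
      using c(4) by (simp add: H_def algebra_simps)
    ultimately show ?thesis
      unfolding eq by (cases "j - i \<le> h") (auto simp: H_def)
  qed
  \<comment> \<open>Distinct \<open>y\<close> thus have circular distance between \<open>b\<close>
    and \<open>tb\<close>. As \<open>b \<ge> 2 * (pi - tb)\<close>, rotating one of them by
    \<open>td\<close> keeps them within \<open>tb\<close>.\<close>
  have gap': "(b \<le> \<bar>y i - y j\<bar> \<and> \<bar>y i - y j\<bar> \<le> H) \<or> (2 * pi - tb \<le> \<bar>y i - y j\<bar> \<and> \<bar>y i - y j\<bar> \<le> 2 * H)"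
    if "i < Suc (2 * h)" "j < Suc (2 * h)" "i \<noteq> j" for i j
    using gap[of i j] gap[of j i] that c pi_gt_zero by (cases "i < j") (auto simp: abs_if)
  show thesis
  proof (rule that[of y z])
    show "y ` {..<Suc (2 * h)} \<subseteq> {0..<2 * pi}"
      using range c by fastforce
    show "z ` {..<Suc (2 * h)} \<subseteq> {0..<2 * pi}"
      using range c by (fastforce simp: z_def)
    show "inj_on y {..<Suc (2 * h)}"
      using gap' c by (fastforce intro!: inj_onI)
    show "inj_on z {..<Suc (2 * h)}"
    proof (rule inj_onI, rule ccontr)
      fix i j assume ij: "i \<in> {..<Suc (2 * h)}" "j \<in> {..<Suc (2 * h)}" "z i = z j" "i \<noteq> j"
      then show False
        using gap'[of i j] c unfolding z_def by (auto split: if_splits)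
    qed
    show "y ` {..<Suc (2 * h)} \<inter> z ` {..<Suc (2 * h)} = {}"
    proof -
      have "y i \<noteq> z j" if "i < Suc (2 * h)" "j < Suc (2 * h)" for i j
        using gap'[OF that] c unfolding z_def by (cases "i = j") (auto split: if_splits)
      then show ?thesis by auto
    qed
    show "min \<bar>y i - z i\<bar> (2 * pi - \<bar>y i - z i\<bar>) = td" if "i < Suc (2 * h)" for i
      using c by (auto simp: z_def)
    show "min \<bar>u - v\<bar> (2 * pi - \<bar>u - v\<bar>) \<le> tb"
      if ij: "i < Suc (2 * h)" "j < Suc (2 * h)" "i \<noteq> j" "u \<in> {y i, z i}" "v \<in> {y j, z j}" for i j u v
    proof -
      have z: "z l = y l + td \<or> z l = y l + td - 2 * pi" for l
        by (simp add: z_def)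
      show ?thesis
        using gap'[OF ij(1-3)] c z[of i] z[of j] ij(4,5)
        unfolding min_le_iff_disj insert_iff empty_iff by (elim disjE) (simp_all; linarith)+
    qed
    have "y 0 - y (Suc h) = - (2 * pi - tb)"
      using c(4) by (simp add: y_def H_def algebra_simps)
    then show "min \<bar>y 0 - y (Suc h)\<bar> (2 * pi - \<bar>y 0 - y (Suc h)\<bar>) = tb"
      using c by simp
  qed
qed

section \<open>The two inclusions on the circle\<close>

text \<open>Nonzero homology throughout \<open>[tb, td)\<close> forces unique antipodes at each of
  these scales: scale \<open>tb\<close> gives the first bound, and a scale of at least
  \<open>pi\<close> would leave no antipodes at all.\<close>

lemma circle_VR_dgm_bounds:
  assumes Y: "Y \<subseteq> mspace circle" "finite Y" "card Y \<le> 2 * k + 2"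
    and dgm: "is_VR_dgm TYPE('f::field) (submetric circle Y) k {#(tb, td)#}"
  shows "real k / (real k + 1) * pi \<le> tb" "td \<le> pi"
proof -
  let ?Y = "submetric circle Y"
  have Y': "mspace ?Y = Y"
    using Y(1) by (auto simp: mspace_submetric)
  have Y0: "Y \<subseteq> {0..<2 * pi}"
    using Y(1) by (simp add: mspace_circle)
  have fin: "finite (mspace ?Y)"
    using Y' Y(2) by simp
  have dist: "mdist ?Y u v = min \<bar>u - v\<bar> (2 * pi - \<bar>u - v\<bar>)" if "u \<in> Y" "v \<in> Y" for u v
    using that Y0 by (simp add: mdist_submetric mdist_circle subset_iff)
  note single = VR_dgm_single[OF fin dgm]
  have card: "card Y = 2 * k + 2"
  proof (rule ccontr)
    assume "card Y \<noteq> 2 * k + 2"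
    then have "exact TYPE('f) Y (\<lambda>x y. mdist ?Y x y \<le> tb) Y (Suc k)"
      using Y by (intro exact_if_card_less) auto
    then show False
      using single(2) single(3)[of tb] Y' by simp
  qed
  have antipodal: "card {u \<in> Y - {v}. \<not> min \<bar>u - v\<bar> (2 * pi - \<bar>u - v\<bar>) \<le> r} = 1"
    if "v \<in> Y" "tb \<le> r" "r < td" for v r
  proof (rule ccontr)
    assume *: "card {u \<in> Y - {v}. \<not> min \<bar>u - v\<bar> (2 * pi - \<bar>u - v\<bar>) \<le> r} \<noteq> 1"
    have "{u \<in> Y - {v}. \<not> (mdist ?Y u v \<le> r \<and> mdist ?Y v u \<le> r)}
        = {u \<in> Y - {v}. \<not> min \<bar>u - v\<bar> (2 * pi - \<bar>u - v\<bar>) \<le> r}"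
      using that(1) dist by (auto simp: abs_minus_commute)
    then have "exact TYPE('f) Y (\<lambda>x y. mdist ?Y x y \<le> r) Y (Suc k)"
      using * Y that(1) by (intro exact_if_not_antipodal[where v = v]) simp_all
    then show False
      using single(3)[OF that(2,3)] Y' by simp
  qed
  show "real k / (real k + 1) * pi \<le> tb"
    using antipodal single(1,2) by (intro antipodal_circle_scale[OF Y(2) Y0 card]) auto
  show "td \<le> pi"
  proof (rule ccontr)
    assume "\<not> td \<le> pi"
    obtain v where v: "v \<in> Y"
      using card by fastforce
    have "{u \<in> Y - {v}. \<not> min \<bar>u - v\<bar> (2 * pi - \<bar>u - v\<bar>) \<le> max tb pi} = {}"
      by (auto simp: min_def max_def)
    moreover have "card {u \<in> Y - {v}. \<not> min \<bar>u - v\<bar> (2 * pi - \<bar>u - v\<bar>) \<le> max tb pi} = 1"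
      using single(2) \<open>\<not> td \<le> pi\<close> by (intro antipodal[OF v]) auto
    ultimately show False
      by (simp only: card.empty zero_neq_one)
  qed
qed

lemma circle_VR_dgm_realized:
  assumes k: "k \<ge> 1" "even k"
    and t: "real k / (real k + 1) * pi \<le> tb" "tb < td" "td \<le> pi"
  shows "\<exists>Y \<subseteq> mspace circle. finite Y \<and> card Y \<le> 2 * k + 2 \<and>
    is_VR_dgm TYPE('f::field) (submetric circle Y) k {#(tb, td)#}"
proof -
  \<comment> \<open>Evenness of \<open>k\<close> makes the number \<open>k + 1\<close> of antipodal
    pairs odd, as the alternating configuration requires.\<close>
  obtain h where h: "k = 2 * h" "h \<ge> 1"
    using k by (auto elim!: evenE)
  have "2 * real h / (2 * real h + 1) * pi \<le> tb"
    using t(1) h by simp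
  from circle_antipodal_configuration[OF h(2) this t(2,3)] obtain y z :: "nat \<Rightarrow> real" where
    sub: "y ` {..<Suc k} \<subseteq> {0..<2 * pi}" "z ` {..<Suc k} \<subseteq> {0..<2 * pi}"
    and inj: "inj_on y {..<Suc k}" "inj_on z {..<Suc k}" "y ` {..<Suc k} \<inter> z ` {..<Suc k} = {}"
    and opp: "\<And>i. i < Suc k \<Longrightarrow> min \<bar>y i - z i\<bar> (2 * pi - \<bar>y i - z i\<bar>) = td"
    and near: "\<And>i j u v. i < Suc k \<Longrightarrow> j < Suc k \<Longrightarrow> i \<noteq> j \<Longrightarrow> u \<in> {y i, z i} \<Longrightarrow> v \<in> {y j, z j} \<Longrightarrow>
       min \<bar>u - v\<bar> (2 * pi - \<bar>u - v\<bar>) \<le> tb"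
    and attained: "min \<bar>y 0 - y (Suc h)\<bar> (2 * pi - \<bar>y 0 - y (Suc h)\<bar>) = tb"
    unfolding h(1)[symmetric] by blast
  define Y where "Y = y ` {..<Suc k} \<union> z ` {..<Suc k}"
  have Y: "Y \<subseteq> mspace circle"
    using sub by (simp add: Y_def mspace_circle)
  have "card Y \<le> 2 * k + 2"
    unfolding Y_def using card_Un_le[of "y ` {..<Suc k}" "z ` {..<Suc k}"]
      card_image_le[of "{..<Suc k}" y] card_image_le[of "{..<Suc k}" z] by simp
  moreover have "is_VR_dgm TYPE('f) (submetric circle Y) k {#(tb, td)#}"
  proof (rule VR_dgm_cross_polytope[OF _ inj])
    have dist: "mdist (submetric circle Y) u v = min \<bar>u - v\<bar> (2 * pi - \<bar>u - v\<bar>)"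
      if "u \<in> Y" "v \<in> Y" for u v
      using that Y unfolding mspace_circle by (simp add: mdist_submetric mdist_circle subset_iff)
    have mem: "y i \<in> Y" "z i \<in> Y" if "i < Suc k" for i
      using that by (auto simp: Y_def)
    show "mspace (submetric circle Y) = y ` {..<Suc k} \<union> z ` {..<Suc k}"
      using Y by (auto simp: mspace_submetric Y_def)
    show "mdist (submetric circle Y) (y i) (z i) = td" if "i < Suc k" for i
      using dist[OF mem[OF that]] opp[OF that] by simp
    show "mdist (submetric circle Y) u v \<le> tb"
      if "i < Suc k" "j < Suc k" "i \<noteq> j" "u \<in> {y i, z i}" "v \<in> {y j, z j}" for i j u v
    proof -
      have "u \<in> Y" "v \<in> Y"
        using that mem by auto
      then show ?thesis
        using near[OF that] by (simp only: dist)
    qed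
    show "0 < Suc k" "Suc h < Suc k" "0 \<noteq> Suc h"
      using h by auto
    then show "mdist (submetric circle Y) (y 0) (y (Suc h)) = tb"
      using dist[of "y 0" "y (Suc h)"] mem attained by simp
    have "0 \<le> real k / (real k + 1) * pi"
      by simp
    then show "0 \<le> tb"
      using t(1) by linarith
  qed (rule t(2))
  ultimately show ?thesis
    using Y by (intro exI[of _ Y]) (simp add: Y_def)
qed

theorem theorem5p4:
  fixes k :: nat
  assumes "k \<ge> 1" and "even k"
  shows "VR_principal_set TYPE('f::field) circle k =
    {(t\<^sub>b, t\<^sub>d). real k / (real k + 1) * pi \<le> t\<^sub>b \<and> t\<^sub>b < t\<^sub>d \<and> t\<^sub>d \<le> pi}"
proof (intro equalityI subsetI; clarify)
  fix tb td assume "(tb, td) \<in> VR_principal_set TYPE('f) circle k"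
  then obtain Y where Y: "Y \<subseteq> mspace circle" "finite Y" "card Y \<le> 2 * k + 2"
    and dgm: "is_VR_dgm TYPE('f) (submetric circle Y) k {#(tb, td)#}"
    unfolding VR_principal_set_def by blast
  have "finite (mspace (submetric circle Y))"
    using Y(2) by (simp add: mspace_submetric)
  from VR_dgm_single(2)[OF this dgm] circle_VR_dgm_bounds[OF Y dgm]
  show "real k / (real k + 1) * pi \<le> tb \<and> tb < td \<and> td \<le> pi"
    by blast
next
  fix tb td assume "real k / (real k + 1) * pi \<le> tb" "tb < td" "td \<le> pi"
  then show "(tb, td) \<in> VR_principal_set TYPE('f) circle k"
    using circle_VR_dgm_realized[OF assms, where ?'f = 'f] unfolding VR_principal_set_def by blast
qed

end
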